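(* Let $M=2^{2\lambda}$ with $\lambda$ a positive integer, and let $\mathcal{S}=\{-(\sqrt M-1)+2n : n=0,1,\dots,\sqrt M-1\}$ be the symmetric $\sqrt M$-PAM signal set. The number $N_{(\sqrt M\text{-}PAM)}$ of singular fade states of $\mathcal{S}$ is $$N_{(\sqrt M\text{-}PAM)}=2+4\sum_{n=2}^{\sqrt M-1} n\prod_{p\mid n}\left(1-\frac1p\right),$$ where the product is over the distinct prime numbers $p$ dividing $n$ (and the sum is $0$ if $\sqrt M=2$).
   Context: A fade state is a nonzero complex number $z=\gamma e^{j\theta}$ ($\gamma>0$, $-\pi\le\theta<\pi$, $j=\sqrt{-1}$). For a finite signal set $\mathcal{S}\subset\mathbb{C}$ used at both end nodes, a fade state $z$ is a singular fade state if $\{x+z y : x,y\in\mathcal{S}\}$ has fewer than $|\mathcal{S}|^2$ elements, equivalently if there are distinct pairs $(x,y)\ne(x',y')$ in $\mathcal{S}^2$ with $x+zy=x'+zy'$. *)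

theory Defs
  imports Complex_Main "HOL-Computational_Algebra.Primes"
begin

definition fade_state :: "complex \<Rightarrow> bool" where
  "fade_state z \<longleftrightarrow> z \<noteq> 0"

definition effective_constellation :: "complex set \<Rightarrow> complex \<Rightarrow> complex set" where
  "effective_constellation S z = {x + z * y | x y. x \<in> S \<and> y \<in> S}"

text \<open>The signal set \<open>S\<close> is meant to be finite; for infinite \<open>S\<close> the cardinalities below
  are not meaningful.\<close>

definition singular_fade_state :: "complex set \<Rightarrow> complex \<Rightarrow> bool" where
  "singular_fade_state S z \<longleftrightarrow>
     fade_state z \<and> card (effective_constellation S z) < (card S)^2"

text \<open>The argument is the square \<open>M\<close> of the number of signal points. It is meant to be a
  perfect square, so that \<open>n\<close> ranges over \<open>0, \<dots>, sqrt M - 1\<close>.\<close>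

definition sqrt_PAM :: "nat \<Rightarrow> complex set" where
  "sqrt_PAM M = {complex_of_real (- (sqrt (real M) - 1) + 2 * real n) | n :: nat.
                   real n \<le> sqrt (real M) - 1}"

end

theory Submission
  imports Defs "HOL-Number_Theory.Totient"
begin

text \<open>A collision \<open>x + z y = x' + z y'\<close> forces \<open>z = (x' - x) / (y - y')\<close>, and the nonzero
  differences of a \<open>q\<close>-point PAM set are \<open>\<plusminus>2a\<close> with \<open>1 \<le> a \<le> q - 1\<close>. Hence the singular fade
  states are exactly \<open>\<plusminus>a / b\<close> with \<open>a, b\<close> coprime in \<open>[1, q - 1]\<close>. Counting such pairs by their
  maximum \<open>n\<close> gives one pair for \<open>n = 1\<close> and \<open>2 \<phi>(n)\<close> pairs for each \<open>n \<ge> 2\<close>.\<close>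

text \<open>Here \<open>q\<close> plays the role of sqrt M, so the index range is free of square
  roots.\<close>

definition pam :: "nat \<Rightarrow> complex set" where
  "pam q = (\<lambda>n. complex_of_real (2 * real n - (real q - 1))) ` {..<q}"

lemma sqrt_PAM_eq_pam: "sqrt_PAM (q ^ 2) = pam q"
  by (auto simp: sqrt_PAM_def pam_def image_iff Bex_def)

lemma finite_pam [simp]: "finite (pam q)"
  by (simp add: pam_def)

text \<open>The image of \<open>S \<times> S\<close> under \<open>(x, y) \<mapsto> x + z * y\<close>
  has at most |S|^2 elements, with equality iff the map is injective. In a collision
  \<open>y = y'\<close> would force \<open>x = x'\<close>, so distinct pairs differ in the second
  coordinate.\<close>

lemma singular_fade_state_iff:
  assumes "finite S"
  shows "singular_fade_state S z \<longleftrightarrow> z \<noteq> 0 \<and>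
    (\<exists>x\<in>S. \<exists>x'\<in>S. \<exists>y\<in>S. \<exists>y'\<in>S. y \<noteq> y' \<and> x + z * y = x' + z * y')"
proof -
  define f where "f = (\<lambda>(x, y). x + z * y)"
  have "effective_constellation S z = f ` (S \<times> S)"
    by (auto simp: effective_constellation_def f_def)
  moreover have "card (f ` (S \<times> S)) < (card S)\<^sup>2 \<longleftrightarrow> \<not> inj_on f (S \<times> S)"
    using assms card_image_le[of "S \<times> S" f] inj_on_iff_eq_card[of "S \<times> S" f]
    by (auto simp: card_cartesian_product power2_eq_square)
  moreover have "\<not> inj_on f (S \<times> S) \<longleftrightarrow>
      (\<exists>x\<in>S. \<exists>x'\<in>S. \<exists>y\<in>S. \<exists>y'\<in>S. y \<noteq> y' \<and> x + z * y = x' + z * y')"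
    by (simp add: inj_on_def f_def) (metis add_right_cancel)
  ultimately show ?thesis
    by (simp add: singular_fade_state_def fade_state_def)
qed

definition coprime_pairs :: "nat \<Rightarrow> (nat \<times> nat) set" where
  "coprime_pairs n = {(a, b) \<in> {1..n} \<times> {1..n}. coprime a b}"

lemma finite_coprime_pairs [simp]: "finite (coprime_pairs n)"
  by (rule finite_subset[of _ "{1..n} \<times> {1..n}"]) (auto simp: coprime_pairs_def)

text \<open>The new pairs have maximum \<open>Suc n\<close>: one coordinate is \<open>Suc n\<close>,
  the other a totative of it.\<close>

lemma card_coprime_pairs_Suc:
  assumes "n \<ge> 1"
  shows "card (coprime_pairs (Suc n)) = card (coprime_pairs n) + 2 * totient (Suc n)"
proof -
  define T where "T = totatives (Suc n)"
  \<comment> \<open>As \<open>Suc n \<ge> 2\<close> is not coprime to itself, its totatives stop at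
    \<open>n\<close>; this also makes the two families of new pairs disjoint.\<close>
  have T: "a \<in> T \<longleftrightarrow> 1 \<le> a \<and> a \<le> n \<and> coprime a (Suc n)" for a
    using assms by (auto simp: T_def totatives_def le_Suc_eq)
  have fin: "finite T" by (simp add: T_def)
  have eq: "coprime_pairs (Suc n) = coprime_pairs n \<union> (T \<times> {Suc n} \<union> {Suc n} \<times> T)"
    using assms by (auto simp: coprime_pairs_def T le_Suc_eq coprime_commute)
  have "card (T \<times> {Suc n} \<union> {Suc n} \<times> T) = card T + card T"
    by (subst card_Un_disjoint) (use fin T in \<open>auto simp: card_cartesian_product\<close>)
  moreover have "coprime_pairs n \<inter> (T \<times> {Suc n} \<union> {Suc n} \<times> T) = {}"
    by (auto simp: coprime_pairs_def)
  ultimately show ?thesis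
    unfolding eq using fin
    by (subst card_Un_disjoint) (auto simp: totient_def T_def)
qed

lemma card_coprime_pairs:
  assumes "n \<ge> 1"
  shows "card (coprime_pairs n) = 1 + 2 * (\<Sum>k=2..n. totient k)"
  using assms
proof (induction n rule: dec_induct)
  case base
  have "coprime_pairs 1 = {(1, 1)}"
    by (auto simp: coprime_pairs_def)
  then show ?case by simp
next
  case (step n)
  then show ?case by (simp add: card_coprime_pairs_Suc)
qed

text \<open>The sign is kept apart from the pair, so that one count of pairs serves both
  signs.\<close>

definition signed_ratio :: "real \<Rightarrow> nat \<times> nat \<Rightarrow> complex" where
  "signed_ratio s p = complex_of_real (s * real (fst p) / real (snd p))"

text \<open>Neighbouring points are 2 apart, so \<open>a\<close> is the distance of the indices and
  \<open>s\<close> records their order.\<close>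

lemma pam_difference:
  assumes "x \<in> pam q" "x' \<in> pam q" "x \<noteq> x'"
  obtains a s where "a \<in> {1..q - 1}" "s \<in> {1, -1}"
    "x' - x = complex_of_real (2 * s * real a)"
proof -
  obtain m n where mn: "m < q" "n < q" "x = complex_of_real (2 * real m - (real q - 1))"
      "x' = complex_of_real (2 * real n - (real q - 1))"
    using assms by (auto simp: pam_def)
  have diff: "x' - x = complex_of_real (2 * (real n - real m))"
    unfolding mn(3,4) by (simp add: algebra_simps)
  show thesis
  proof (cases "m < n")
    case True
    then show thesis using mn(1,2) diff
      by (intro that[of "n - m" 1]) (auto simp: of_nat_diff)
  next
    case False
    moreover have "m \<noteq> n" using assms mn by auto
    ultimately show thesis using mn(1,2) diff
      by (intro that[of "m - n" "-1"]) (auto simp: of_nat_diff)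
  qed
qed

text \<open>Cancelling the gcd keeps the ratio and only shrinks both entries, so they stay in
  range.\<close>

lemma signed_ratio_in_image_coprime_pairs:
  assumes "a \<in> {1..n}" "b \<in> {1..n}"
  shows "signed_ratio s (a, b) \<in> signed_ratio s ` coprime_pairs n"
proof -
  define g where "g = gcd a b"
  have g: "g > 0" using assms by (auto simp: g_def)
  have "a div g \<in> {1..n}" "b div g \<in> {1..n}"
    using assms g by (auto simp: g_def div_greater_zero_iff Suc_le_eq intro: order.trans[OF div_le_dividend])
  moreover have "coprime (a div g) (b div g)"
    using g unfolding g_def by (intro div_gcd_coprime) auto
  moreover have "signed_ratio s (a, b) = signed_ratio s (a div g, b div g)"
    using g by (simp add: signed_ratio_def g_def real_of_nat_div)
  ultimately show ?thesis by (force simp: coprime_pairs_def)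
qed

lemma singular_fade_states_pam:
  "{z. singular_fade_state (pam q) z} =
     signed_ratio 1 ` coprime_pairs (q - 1) \<union> signed_ratio (-1) ` coprime_pairs (q - 1)"
  (is "?L = ?R")
proof (intro equalityI subsetI)
  fix z assume "z \<in> ?L"
  then obtain x x' y y' where xy: "x \<in> pam q" "x' \<in> pam q" "y \<in> pam q" "y' \<in> pam q"
      "y \<noteq> y'" "x + z * y = x' + z * y'" "z \<noteq> 0"
    by (auto simp: singular_fade_state_iff)
  then have "x \<noteq> x'" by auto
  from pam_difference[OF xy(1,2) this] obtain a s where a: "a \<in> {1..q - 1}" "s \<in> {1, -1}"
      "x' - x = complex_of_real (2 * s * real a)" .
  from pam_difference[OF xy(4,3) xy(5)[symmetric]] obtain b t where b: "b \<in> {1..q - 1}" "t \<in> {1, -1}"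
      "y - y' = complex_of_real (2 * t * real b)" .
  have "z * (y - y') = x' - x" using xy(6) by (simp add: algebra_simps)
  then have "z = (x' - x) / (y - y')" using xy(5) by (simp add: field_simps)
  \<comment> \<open>The factors 2 cancel, and \<open>s / t = s * t\<close> because \<open>t\<close>
    is 1 or -1.\<close>
  then have "z = signed_ratio (s * t) (a, b)"
    using a b by (auto simp: signed_ratio_def)
  then show "z \<in> ?R" using a b signed_ratio_in_image_coprime_pairs[of a "q - 1" b "s * t"] by auto
next
  fix z assume "z \<in> ?R"
  then obtain a b s where ab: "(a, b) \<in> coprime_pairs (q - 1)" "s \<in> {1, -1}"
      "z = signed_ratio s (a, b)" by auto
  \<comment> \<open>The witnesses are measured from the lowest point \<open>P 0\<close>:
    \<open>P a - P 0 = 2 * a\<close> and \<open>P b - P 0 = 2 * b\<close>.\<close>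
  define P where "P = (\<lambda>n. complex_of_real (2 * real n - (real q - 1)))"
  have mem: "P a \<in> pam q" "P 0 \<in> pam q" "P b \<in> pam q"
    using ab by (auto simp: P_def pam_def coprime_pairs_def)
  have z: "z \<noteq> 0" and b: "b > 0"
    using ab by (auto simp: signed_ratio_def coprime_pairs_def)
  then have "P b \<noteq> P 0" by (auto simp: P_def)
  have zb: "z * of_nat b = of_real s * of_nat a"
    using ab b by (simp add: signed_ratio_def)
  \<comment> \<open>From \<open>zb\<close>, \<open>z * (P b - P 0) = s * (P a - P 0)\<close>; the
    sign \<open>s\<close> decides on which side \<open>P b\<close> stands.\<close>
  have "P a + z * P 0 = P 0 + z * P b \<or> P a + z * P b = P 0 + z * P 0"
  proof (cases "s = 1")
    case True
    then show ?thesis using zb by (simp add: P_def algebra_simps)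
  next
    case False
    then have "z * of_nat b = - of_nat a" using ab zb by simp
    then show ?thesis by (simp add: P_def algebra_simps flip: mult.assoc)
  qed
  with mem \<open>P b \<noteq> P 0\<close> have "\<exists>x\<in>pam q. \<exists>x'\<in>pam q. \<exists>y\<in>pam q. \<exists>y'\<in>pam q.
      y \<noteq> y' \<and> x + z * y = x' + z * y'"
    by metis
  with z show "z \<in> ?L" by (simp add: singular_fade_state_iff)
qed

text \<open>A positive rational has only one representation in lowest terms: cross-multiplying and
  using coprimality identifies the entries.\<close>

lemma inj_on_signed_ratio:
  assumes "s \<noteq> 0"
  shows "inj_on (signed_ratio s) (coprime_pairs n)"
proof (intro inj_onI, clarify)
  fix a b c d
  assume *: "(a, b) \<in> coprime_pairs n" "(c, d) \<in> coprime_pairs n"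
    "signed_ratio s (a, b) = signed_ratio s (c, d)"
  then have "s * real a / real b = s * real c / real d"
    unfolding signed_ratio_def of_real_eq_iff by simp
  then have "real a / real b = real c / real d"
    using assms by (metis mult_left_cancel times_divide_eq_right)
  then have "real (a * d) = real (c * b)"
    using * by (simp add: coprime_pairs_def frac_eq_eq)
  then have "a * d = c * b" by (simp only: of_nat_eq_iff)
  with * show "a = c \<and> b = d"
    using coprime_crossproduct_nat[of a b c d] by (auto simp: coprime_pairs_def)
qed

lemma card_singular_fade_states_pam:
  "card {z. singular_fade_state (pam q) z} = 2 * card (coprime_pairs (q - 1))"
proof -
  \<comment> \<open>The two images are separated by sign, one being positive and the other
    negative.\<close>
  have "signed_ratio 1 p \<noteq> signed_ratio (-1) p'"
    if "p \<in> coprime_pairs (q - 1)" "p' \<in> coprime_pairs (q - 1)" for p p'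
  proof -
    have "real (fst p) / real (snd p) > 0" "real (fst p') / real (snd p') > 0"
      using that by (auto simp: coprime_pairs_def)
    then show ?thesis unfolding signed_ratio_def of_real_eq_iff by simp
  qed
  then have "signed_ratio 1 ` coprime_pairs (q - 1) \<inter> signed_ratio (-1) ` coprime_pairs (q - 1) = {}"
    by blast
  then show ?thesis
    unfolding singular_fade_states_pam
    by (subst card_Un_disjoint) (simp_all add: card_image inj_on_signed_ratio)
qed

theorem lemma2:
  fixes l M :: nat
  assumes "l > 0" and "M = 2 ^ (2 * l)"
  shows "real (card {z. singular_fade_state (sqrt_PAM M) z}) =
    2 + 4 * (\<Sum>n :: nat | 2 \<le> n \<and> real n \<le> sqrt (real M) - 1.
               real n * (\<Prod>p \<in> prime_factors n. 1 - 1 / real p))"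
proof -
  define q :: nat where "q = 2 ^ l"
  have q: "q \<ge> 2" using assms(1) self_le_power[of "2::nat" l] by (simp add: q_def)
  have M: "M = q\<^sup>2" using assms(2) by (simp add: q_def power_mult mult.commute)
  \<comment> \<open>For \<open>q = 2\<close> both sides are empty, which gives the sum 0.\<close>
  have ind: "{n. 2 \<le> n \<and> real n \<le> sqrt (real M) - 1} = {2..q - 1}"
    using q by (auto simp: M)
  have "card {z. singular_fade_state (sqrt_PAM M) z} = 2 + 4 * (\<Sum>n=2..q - 1. totient n)"
    using q by (simp add: M sqrt_PAM_eq_pam card_singular_fade_states_pam card_coprime_pairs)
  then show ?thesis
    \<comment> \<open>Euler's product formula turns each totient into the product over prime
      factors.\<close>
    unfolding ind by (simp add: totient_formula2)
qed

end
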